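(* Let $\mathcal{D}\subseteq\mathbb{R}^n$ be open, let $f\colon\mathcal{D}\to\mathbb{R}^n$ be locally Lipschitz and $G\colon\mathcal{D}\to\mathbb{R}^{n\times m}$ be continuous. Let $h_1,\ldots,h_p\colon\mathcal{D}\to\mathbb{R}$ be continuously differentiable, and let $$h(x)\triangleq\min_{c\in\{1,\ldots,q\}}M_c(x),\qquad M_c(x)\triangleq\max_{i\in\mathcal{S}_c}h_i(x),$$ where each $\mathcal{S}_c\subseteq\{1,\ldots,p\}$ is nonempty. Let $\mathcal{C}\triangleq\{x\in\mathcal{D}:h(x)\ge0\}$. Let $\alpha\in\mathcal{K}_e$, and suppose the following assumption holds: for all $x\in\mathcal{D}$ and all $c\in\mathcal{A}^{\mathrm{c}}_0(x)$ with $M_c(x)=0$, the row vector $L_Gh_{i_c(x)}(x)\in\mathbb{R}^{1\times m}$ is nonzero, and there exists $u\in\mathbb{R}^m$ such that, for all $c'\in\mathcal{A}^{\mathrm{c}}_0(x)$, $L_fh_{i_{c'}(x)}(x)+L_Gh_{i_{c'}(x)}(x)\,u+\alpha\big(h_{i_{c'}(x)}(x)\big)\ge0$. Let $\delta>0$, and let $u_*\colon\mathcal{D}\to\mathbb{R}^m$ be locally Lipschitz such that, for all $x\in\mathcal{D}$ and all $c\in\mathcal{A}^{\mathrm{c}}_\delta(x)$, $$L_fh_{i_c(x)}(x)+L_Gh_{i_c(x)}(x)\,u_*(x)+\alpha\big(h_{i_c(x)}(x)\big)\ge0,$$ where the Lie derivatives are obtained from the dual-algebraic evaluation, $L_fh_i(x)=\mathfrak{D}\big(\tilde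 h_i(x_{\mathbb{D},f})\big)$ and $L_{\mathrm{col}_j(G)}h_i(x)=\mathfrak{D}\big(\tilde h_i(x_{\mathbb{D},\mathrm{col}_j(G)})\big)$. Then $\mathcal{C}$ is forward invariant with respect to the closed-loop system $\dot x=f(x)+G(x)u_*(x)$.
   Context: $\mathcal{K}_e$ (extended class-$\mathcal{K}$) is the set of continuous functions $\alpha\colon(-b,a)\to\mathbb{R}$, $a,b>0$, that are increasing with $\alpha(0)=0$; wherever $\alpha(s)$ is written, $s$ is understood to lie in the domain of $\alpha$. For $\delta\ge0$ the $\delta$-active clause set is $\mathcal{A}^{\mathrm{c}}_\delta(x)\triangleq\{c\in\{1,\ldots,q\}:M_c(x)\le h(x)+\delta\}$. For each clause $c$, the routed leaf $i_c(x)\in\mathcal{S}_c$ is the index selected by reducing the dual values of the $h_i$, $i\in\mathcal{S}_c$ (listed in a fixed order), with the binary operation $\max_\Re(z_1,z_2)\triangleq z_1$ if $\Re(z_1)\ge\Re(z_2)$, else $z_2$; it depends only on the real values and satisfies $h_{i_c(x)}(x)=M_c(x)$ (for left-to-right reduction it is the first index in the list attaining the maximum). Lie derivatives: $L_fh_i(x)\triangleq\nabla h_i(x)f(x)$, $L_Gh_i(x)\triangleq\nabla h_i(x)G(x)\in\mathbb{R}^{1\times m}$, with $\nabla h_i$ a row vector; $\mathrm{col}_j(G)$ is the $j$-th column of $G$. Dual numbers: $\mathbb{D}\triangleq\mathbb{R}[\epsilon]/(\epsilon^2)$, $\Re(a+b\epsilon)\triangleq a$, $\mathfrak{D}(a+b\epsilon)\triangleq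 b$. For a vector field $v$, $x_{\mathbb{D},v}\triangleq x+v(x)\epsilon\in\mathbb{D}^n$, and the dual extension of $h_i$ is $\tilde h_i(x+w\epsilon)\triangleq h_i(x)+\nabla h_i(x)\,w\,\epsilon$. Forward invariance of $\mathcal{C}$ means: every solution $x(\cdot)$ of the closed-loop system with $x(0)\in\mathcal{C}$ satisfies $x(t)\in\mathcal{C}$ for all $t\ge0$ in its interval of existence. *)

theory Defs
  imports "HOL-Analysis.Analysis"
begin

section \<open>Dual numbers\<close>

datatype dual_num = Dual (dre: real) (ddu: real)

instantiation dual_num :: comm_ring_1
begin

definition zero_dual_num where "0 = Dual 0 0"
definition one_dual_num where "1 = Dual 1 0"
definition plus_dual_num where "z + w = Dual (dre z + dre w) (ddu z + ddu w)"
definition uminus_dual_num where "- z = Dual (- dre z) (- ddu z)"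
definition minus_dual_num where "z - w = Dual (dre z - dre w) (ddu z - ddu w)"
definition times_dual_num where
  "z * w = Dual (dre z * dre w) (dre z * ddu w + ddu z * dre w)"

instance
  by standard
    (auto simp: zero_dual_num_def one_dual_num_def plus_dual_num_def uminus_dual_num_def
      minus_dual_num_def times_dual_num_def algebra_simps)

end

definition dual_eps :: dual_num where "dual_eps = Dual 0 1"

lemma dual_eps_square: "dual_eps * dual_eps = 0"
  by (simp add: dual_eps_def times_dual_num_def zero_dual_num_def)

lemma Dual_decomp: "Dual a b = Dual a 0 + Dual b 0 * dual_eps"
  by (simp add: dual_eps_def times_dual_num_def plus_dual_num_def)

text \<open>The point \<open>x + v(x) \<epsilon>\<close>.\<close>

definition seed :: "(real^'n \<Rightarrow> real^'n) \<Rightarrow> real^'n \<Rightarrow> dual_num^'n" where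
  "seed v x = (\<chi> k. Dual (x $ k) (v x $ k))"

definition vec_dre :: "dual_num^'n \<Rightarrow> real^'n" where
  "vec_dre X = (\<chi> k. dre (X $ k))"

definition vec_ddu :: "dual_num^'n \<Rightarrow> real^'n" where
  "vec_ddu X = (\<chi> k. ddu (X $ k))"

section \<open>Gradients, Lie derivatives and their dual evaluation\<close>

text \<open>Vectors of partial derivatives, serving as row vectors. Only meaningful where \<open>h\<close> is
  differentiable, as it is on the (open) domain wherever this is used.\<close>

definition grad :: "(real^'n \<Rightarrow> real) \<Rightarrow> real^'n \<Rightarrow> real^'n" where
  "grad h x = (\<chi> k. frechet_derivative h (at x) (axis k 1))"

definition cont_diff_on :: "(real^'n) set \<Rightarrow> (real^'n \<Rightarrow> real) \<Rightarrow> bool" where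
  "cont_diff_on D h \<longleftrightarrow> (\<forall>x\<in>D. h differentiable (at x)) \<and> continuous_on D (grad h)"

definition lie :: "(real^'n \<Rightarrow> real^'n) \<Rightarrow> (real^'n \<Rightarrow> real) \<Rightarrow> real^'n \<Rightarrow> real" where
  "lie f h x = grad h x \<bullet> f x"

text \<open>A matrix field with \<open>n\<close> rows and \<open>m\<close> columns has type \<open>real^'m^'n\<close>.\<close>

definition lie_row :: "(real^'n \<Rightarrow> real^'m^'n) \<Rightarrow> (real^'n \<Rightarrow> real) \<Rightarrow> real^'n \<Rightarrow> real^'m" where
  "lie_row G h x = grad h x v* G x"

definition dual_ext :: "(real^'n \<Rightarrow> real) \<Rightarrow> dual_num^'n \<Rightarrow> dual_num" where
  "dual_ext h X = Dual (h (vec_dre X)) (grad h (vec_dre X) \<bullet> vec_ddu X)"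

definition dual_lie :: "(real^'n \<Rightarrow> real^'n) \<Rightarrow> (real^'n \<Rightarrow> real) \<Rightarrow> real^'n \<Rightarrow> real" where
  "dual_lie v h x = ddu (dual_ext h (seed v x))"

definition dual_lie_row ::
    "(real^'n \<Rightarrow> real^'m^'n) \<Rightarrow> (real^'n \<Rightarrow> real) \<Rightarrow> real^'n \<Rightarrow> real^'m" where
  "dual_lie_row G h x = (\<chi> j. dual_lie (\<lambda>y. column j (G y)) h x)"

lemma vec_seed [simp]: "vec_dre (seed v x) = x" "vec_ddu (seed v x) = v x"
  by (simp_all add: vec_dre_def vec_ddu_def seed_def)

lemma grad_frechet_derivative:
  assumes "h differentiable (at x)"
  shows "(h has_derivative (\<lambda>w. grad h x \<bullet> w)) (at x)"
proof -
  let ?h' = "frechet_derivative h (at x)"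
  have d: "(h has_derivative ?h') (at x)"
    using assms by (simp add: frechet_derivative_works)
  then have lin: "linear ?h'" by (rule has_derivative_linear)
  have "?h' w = grad h x \<bullet> w" for w
  proof -
    have "?h' w = ?h' (\<Sum>k\<in>UNIV. w $ k *\<^sub>R axis k 1)"
      using basis_expansion[of w] by (simp add: scalar_mult_eq_scaleR)
    also have "\<dots> = (\<Sum>k\<in>UNIV. w $ k *\<^sub>R ?h' (axis k 1))"
      by (simp add: linear_sum[OF lin] linear_cmul[OF lin])
    finally show ?thesis by (simp add: grad_def inner_vec_def mult.commute)
  qed
  then have "?h' = (\<lambda>w. grad h x \<bullet> w)" by blast
  with d show ?thesis by simp
qed

lemma dual_lie_eq: "dual_lie v h x = lie v h x"
  by (simp add: dual_lie_def dual_ext_def lie_def)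

lemma dual_lie_row_eq: "dual_lie_row G h x = lie_row G h x"
  by (simp add: dual_lie_row_def lie_row_def dual_lie_eq lie_def vec_eq_iff
      vector_matrix_mult_def column_def inner_vec_def mult.commute)

section \<open>Clauses, active clauses and routed leaves\<close>

text \<open>A clause is given by the list \<open>L\<close> of its leaf indices, in the order in which they are
  reduced.\<close>

definition clause_val :: "(nat \<Rightarrow> real^'n \<Rightarrow> real) \<Rightarrow> nat list \<Rightarrow> real^'n \<Rightarrow> real" where
  "clause_val h L x = Max ((\<lambda>i. h i x) ` set L)"

definition min_max ::
    "(nat \<Rightarrow> real^'n \<Rightarrow> real) \<Rightarrow> nat \<Rightarrow> (nat \<Rightarrow> nat list) \<Rightarrow> real^'n \<Rightarrow> real" where
  "min_max h q S x = Min ((\<lambda>c. clause_val h (S c) x) ` {1..q})"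

definition active_clauses ::
    "(nat \<Rightarrow> real^'n \<Rightarrow> real) \<Rightarrow> nat \<Rightarrow> (nat \<Rightarrow> nat list) \<Rightarrow> real \<Rightarrow> real^'n \<Rightarrow> nat set" where
  "active_clauses h q S \<delta> x = {c \<in> {1..q}. clause_val h (S c) x \<le> min_max h q S x + \<delta>}"

definition max_Re :: "dual_num \<Rightarrow> dual_num \<Rightarrow> dual_num" where
  "max_Re z1 z2 = (if dre z1 \<ge> dre z2 then z1 else z2)"

text \<open>\<open>max_Re\<close> on dual values that carry the index of the leaf they come from.\<close>

definition max_Re_tag :: "nat \<times> dual_num \<Rightarrow> nat \<times> dual_num \<Rightarrow> nat \<times> dual_num" where
  "max_Re_tag s t = (if dre (snd s) \<ge> dre (snd t) then s else t)"

lemma snd_max_Re_tag: "snd (max_Re_tag s t) = max_Re (snd s) (snd t)"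
  by (simp add: max_Re_tag_def max_Re_def)

text \<open>The operation is associative, so the bracketing of a reduction does not matter.\<close>

lemma max_Re_tag_assoc: "max_Re_tag (max_Re_tag r s) t = max_Re_tag r (max_Re_tag s t)"
  by (auto simp: max_Re_tag_def)

definition reduce :: "('a \<Rightarrow> 'a \<Rightarrow> 'a) \<Rightarrow> 'a list \<Rightarrow> 'a" where
  "reduce g xs = foldl g (hd xs) (tl xs)"

definition route :: "(nat \<Rightarrow> real^'n \<Rightarrow> real) \<Rightarrow> nat list \<Rightarrow> dual_num^'n \<Rightarrow> nat" where
  "route h L X = fst (reduce max_Re_tag (map (\<lambda>i. (i, dual_ext (h i) X)) L))"

text \<open>The seed direction is irrelevant for the selected index (see \<open>route_seed\<close>); the zero
  direction is used.\<close>

definition routed_leaf :: "(nat \<Rightarrow> real^'n \<Rightarrow> real) \<Rightarrow> nat list \<Rightarrow> real^'n \<Rightarrow> nat" where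
  "routed_leaf h L x = route h L (seed (\<lambda>_. 0) x)"

lemma foldl_max_Re_tag_indep:
  assumes "\<And>i. dre (g i) = dre (g' i)"
  shows "fst (foldl max_Re_tag (i, g i) (map (\<lambda>i. (i, g i)) L))
       = fst (foldl max_Re_tag (i, g' i) (map (\<lambda>i. (i, g' i)) L))"
  by (induction L arbitrary: i) (auto simp: max_Re_tag_def assms)

lemma route_seed:
  assumes "L \<noteq> []"
  shows "route h L (seed v x) = routed_leaf h L x"
proof -
  obtain i L' where L: "L = i # L'" using assms by (cases L) auto
  show ?thesis unfolding route_def routed_leaf_def reduce_def L
    by (simp, rule foldl_max_Re_tag_indep) (simp add: dual_ext_def)
qed

lemma foldl_max_Re_tag:
  "\<exists>j \<in> insert i (set L). foldl max_Re_tag (i, g i) (map (\<lambda>i. (i, g i)) L) = (j, g j) \<and>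
     (\<forall>k \<in> insert i (set L). dre (g k) \<le> dre (g j))"
proof (induction L arbitrary: i)
  case (Cons a L)
  show ?case
    using Cons.IH[of i] Cons.IH[of a] by (cases "dre (g a) \<le> dre (g i)") (auto simp: max_Re_tag_def)
qed simp

lemma routed_leaf:
  assumes "L \<noteq> []"
  shows "routed_leaf h L x \<in> set L" "h (routed_leaf h L x) x = clause_val h L x"
proof -
  obtain i L' where L: "L = i # L'" using assms by (cases L) auto
  have "\<exists>j \<in> set L. routed_leaf h L x = j \<and> (\<forall>k\<in>set L. h k x \<le> h j x)"
    using foldl_max_Re_tag[of i L' "\<lambda>i. dual_ext (h i) (seed (\<lambda>_. 0) x)"]
    unfolding routed_leaf_def route_def reduce_def L
    by (auto simp: dual_ext_def)
  then obtain j where j: "j \<in> set L" "routed_leaf h L x = j" "\<forall>k\<in>set L. h k x \<le> h j x"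
    by blast
  show "routed_leaf h L x \<in> set L" using j by simp
  show "h (routed_leaf h L x) x = clause_val h L x"
    unfolding clause_val_def using j by (intro Max_eqI[symmetric]) auto
qed

section \<open>Comparison functions, solutions, forward invariance\<close>

text \<open>The domain \<open>(-b, a)\<close> is passed explicitly; values of \<open>\<alpha>\<close> outside it are irrelevant.
  As usual for class-K functions, ``increasing'' is strict.\<close>

definition ext_class_K :: "real \<Rightarrow> real \<Rightarrow> (real \<Rightarrow> real) \<Rightarrow> bool" where
  "ext_class_K b a \<alpha> \<longleftrightarrow> 0 < b \<and> 0 < a \<and> continuous_on {-b<..<a} \<alpha> \<and>
     strict_mono_on {-b<..<a} \<alpha> \<and> \<alpha> 0 = 0"

text \<open>The library's notion for time-dependent fields, at a field not depending on time.\<close>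

abbreviation locally_lipschitz_on ::
    "'a::metric_space set \<Rightarrow> ('a \<Rightarrow> 'b::metric_space) \<Rightarrow> bool" where
  "locally_lipschitz_on D f \<equiv> local_lipschitz (UNIV :: real set) D (\<lambda>_. f)"

text \<open>\<open>J\<close> is any interval of existence containing the initial time 0, not necessarily maximal;
  derivatives at end points of \<open>J\<close> are one-sided.\<close>

definition ode_solution_on ::
    "('a::real_normed_vector) set \<Rightarrow> ('a \<Rightarrow> 'a) \<Rightarrow> real set \<Rightarrow> (real \<Rightarrow> 'a) \<Rightarrow> bool" where
  "ode_solution_on D F J x \<longleftrightarrow> is_interval J \<and> 0 \<in> J \<and>
     (\<forall>t\<in>J. x t \<in> D \<and> (x has_vector_derivative F (x t)) (at t within J))"

definition forward_invariant ::
    "('a::real_normed_vector) set \<Rightarrow> ('a \<Rightarrow> 'a) \<Rightarrow> 'a set \<Rightarrow> bool" where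
  "forward_invariant D F C \<longleftrightarrow>
     (\<forall>J x. ode_solution_on D F J x \<and> x 0 \<in> C \<longrightarrow> (\<forall>t\<in>J. 0 \<le> t \<longrightarrow> x t \<in> C))"

end

theory Submission
  imports Defs
begin

text \<open>Where \<open>h\<close> is negative, every clause attaining the minimum has a routed leaf whose derivative
  along the flow is at least \<open>- \<alpha>(h) > 0\<close>. A clause value dominates its leaves, so just after
  such a time \<open>h\<close> has not dropped. A solution therefore cannot cross any level \<open>v < 0\<close> downwards:
  the last time at which \<open>h \<ge> v\<close> could always be postponed.\<close>

text \<open>A finite minimum of finite maxima unfolds into conditions on single leaves, which are
  differentiable, whereas \<open>min_max\<close> need not be.\<close>

lemma min_max_ge_iff:
  assumes "1 \<le> q" "\<And>c. c \<in> {1..q} \<Longrightarrow> S c \<noteq> []"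
  shows "v \<le> min_max h q S x \<longleftrightarrow> (\<forall>c\<in>{1..q}. \<exists>i\<in>set (S c). v \<le> h i x)"
proof -
  have "v \<le> clause_val h (S c) x \<longleftrightarrow> (\<exists>i\<in>set (S c). v \<le> h i x)" if "c \<in> {1..q}" for c
    using assms(2)[OF that] by (simp add: clause_val_def Max_ge_iff)
  then show ?thesis
    using assms(1) by (simp add: min_max_def)
qed

lemma ext_class_K_neg:
  assumes "ext_class_K b a \<alpha>" "s \<in> {-b<..<a}" "s < 0"
  shows "\<alpha> s < 0"
  using assms strict_mono_onD[of "{-b<..<a}" \<alpha> s 0] by (auto simp: ext_class_K_def)

lemma has_real_derivative_along_curve:
  assumes "h differentiable (at (x t))" "(x has_vector_derivative w) (at t within J)"
  shows "((\<lambda>t. h (x t)) has_real_derivative grad h (x t) \<bullet> w) (at t within J)"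
proof -
  have "((\<lambda>t. h (x t)) has_vector_derivative grad h (x t) \<bullet> w) (at t within J)"
    using vector_derivative_diff_chain_within[OF assms(2)
        has_derivative_at_withinI[OF grad_frechet_derivative[OF assms(1)]]]
    by (simp add: o_def)
  then show ?thesis
    by (simp add: has_real_derivative_iff_has_vector_derivative)
qed

lemma lie_closed_loop:
  "grad h x \<bullet> (f x + G x *v u) = lie f h x + lie_row G h x \<bullet> u"
  by (simp add: lie_def lie_row_def inner_add_right dot_lmul_matrix)

text \<open>Induction along an interval: by compactness, \<open>A\<close> has a largest point in
  \<open>{a..T}\<close>, and \<open>step\<close> would exceed it unless it is
  \<open>T\<close>.\<close>

lemma closed_last_point:
  fixes A :: "real set"
  assumes "closed A" "a \<in> A" "a \<le> T"
    and step: "\<And>s. s \<in> A \<Longrightarrow> a \<le> s \<Longrightarrow> s < T \<Longrightarrow> \<exists>r\<in>A. s < r \<and> r \<le> T"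
  shows "T \<in> A"
proof -
  have "compact (A \<inter> {a..T})" "A \<inter> {a..T} \<noteq> {}"
    using assms by (auto simp: closed_Int_compact)
  then obtain s where s: "s \<in> A \<inter> {a..T}" "\<And>r. r \<in> A \<inter> {a..T} \<Longrightarrow> r \<le> s"
    using compact_attains_sup[of "A \<inter> {a..T}"] by blast
  show ?thesis
  proof (cases "s = T")
    case False
    then obtain r where "r \<in> A" "s < r" "r \<le> T"
      using step[of s] s by auto
    then show ?thesis using s by force
  qed (use s in auto)
qed

theorem theorem5:
  fixes D :: "(real^'n) set"
    and f :: "real^'n \<Rightarrow> real^'n"
    and G :: "real^'n \<Rightarrow> real^'m^'n"
    and h :: "nat \<Rightarrow> real^'n \<Rightarrow> real"
    and p q :: nat
    and S :: "nat \<Rightarrow> nat list"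
    and \<alpha> :: "real \<Rightarrow> real"
    and a b \<delta> :: real
    and ustar :: "real^'n \<Rightarrow> real^'m"
  assumes "open D"
    and "locally_lipschitz_on D f"
    and "continuous_on D G"
    and "\<And>i. i \<in> {1..p} \<Longrightarrow> cont_diff_on D (h i)"
    and "1 \<le> q"
    and "\<And>c. c \<in> {1..q} \<Longrightarrow> S c \<noteq> [] \<and> distinct (S c) \<and> set (S c) \<subseteq> {1..p}"
    and "ext_class_K b a \<alpha>"
    and "\<And>x c. x \<in> D \<Longrightarrow> c \<in> active_clauses h q S 0 x \<Longrightarrow> clause_val h (S c) x = 0 \<Longrightarrow>
      lie_row G (h (routed_leaf h (S c) x)) x \<noteq> 0 \<and>
      (\<exists>u :: real^'m. \<forall>c' \<in> active_clauses h q S 0 x.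
        let i = routed_leaf h (S c') x in
          h i x \<in> {-b<..<a} \<and>
          lie f (h i) x + lie_row G (h i) x \<bullet> u + \<alpha> (h i x) \<ge> 0)"
    and "0 < \<delta>"
    and "locally_lipschitz_on D ustar"
    and "\<And>x c. x \<in> D \<Longrightarrow> c \<in> active_clauses h q S \<delta> x \<Longrightarrow>
      (let i = routed_leaf h (S c) x in
          h i x \<in> {-b<..<a} \<and>
          dual_lie f (h i) x + dual_lie_row G (h i) x \<bullet> ustar x + \<alpha> (h i x) \<ge> 0)"
  shows "forward_invariant D (\<lambda>x. f x + G x *v ustar x) {x \<in> D. min_max h q S x \<ge> 0}"
proof -
  let ?F = "\<lambda>x. f x + G x *v ustar x"
  have leaf: "S c \<noteq> []" "set (S c) \<subseteq> {1..p}" if "c \<in> {1..q}" for c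
    using assms(6)[OF that] by auto
  have diff: "h i differentiable (at x)" if "i \<in> {1..p}" "x \<in> D" for i x
    using assms(4)[OF that(1)] that(2) by (auto simp: cont_diff_on_def)
  have ge_iff: "v \<le> min_max h q S y \<longleftrightarrow> (\<forall>c\<in>{1..q}. \<exists>i\<in>set (S c). v \<le> h i y)" for v y
    using assms(5) leaf(1) by (rule min_max_ge_iff)
  have "0 \<le> min_max h q S (x T)"
    if sol: "ode_solution_on D ?F J x" and init: "0 \<le> min_max h q S (x 0)"
      and T: "T \<in> J" "0 \<le> T" for J x T
  proof -
    have J: "{0..T} \<subseteq> J"
      using sol T mem_is_interval_1_I[of J 0 T] by (auto simp: ode_solution_on_def)
    have inD: "x t \<in> D" if "t \<in> {0..T}" for t
      using sol J that by (auto simp: ode_solution_on_def)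
    have deriv: "((\<lambda>t. h i (x t)) has_real_derivative
        lie f (h i) (x t) + lie_row G (h i) (x t) \<bullet> ustar (x t)) (at t within {0..T})"
      if "i \<in> {1..p}" "t \<in> {0..T}" for i t
    proof -
      have "(x has_vector_derivative ?F (x t)) (at t within {0..T})"
        using sol J that(2) has_vector_derivative_within_subset
        unfolding ode_solution_on_def by blast
      then show ?thesis
        using has_real_derivative_along_curve[of "h i" x t] diff[OF that(1) inD[OF that(2)]]
        by (simp flip: lie_closed_loop)
    qed
    have cont: "continuous_on {0..T} (\<lambda>t. h i (x t))" if "i \<in> {1..p}" for i
      using deriv[OF that] by (rule DERIV_continuous_on)
    \<comment> \<open>Levels strictly below 0 are used because \<alpha> is strictly negative there.
      At level 0 the constraint only gives a nonnegative derivative, which does not force a leaf to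
      increase.\<close>
    have barrier: "v \<le> min_max h q S (x T)" if "v < 0" for v
    proof -
      define A where "A = {t\<in>{0..T}. v \<le> min_max h q S (x t)}"
      have "closed {t\<in>{0..T}. v \<le> h i (x t)}" if "i \<in> {1..p}" for i
        using continuous_on_closed_Collect_le[OF continuous_on_const cont[OF that]] by simp
      \<comment> \<open>By \<open>ge_iff\<close>, \<open>A\<close> is a finite intersection of
        finite unions of closed superlevel sets of leaves.\<close>
      then have "closed ({0..T} \<inter> (\<Inter>c\<in>{1..q}. \<Union>i\<in>set (S c). {t\<in>{0..T}. v \<le> h i (x t)}))"
        using leaf(2) by (intro closed_Int closed_INT ballI closed_UN) (blast | simp)+
      also have "\<dots> = A"
        by (auto simp: A_def ge_iff)
      finally have "closed A" .
      moreover have "0 \<in> A"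
        using T init \<open>v < 0\<close> by (simp add: A_def)
      moreover have "\<exists>r\<in>A. s < r \<and> r \<le> T" if s: "s \<in> A" "0 \<le> s" "s < T" for s
      proof -
        have "\<forall>\<^sub>F r in at_right s. \<exists>i\<in>set (S c). v \<le> h i (x r)" if c: "c \<in> {1..q}" for c
        proof -
          \<comment> \<open>The leaf is frozen at time \<open>s\<close>. It may stop being the
            routed one later, but as a member of the clause it still witnesses the bound.\<close>
          define i where "i = routed_leaf h (S c) (x s)"
          have i: "i \<in> set (S c)" "i \<in> {1..p}" "h i (x s) = clause_val h (S c) (x s)"
            unfolding i_def using routed_leaf[OF leaf(1)[OF c]] leaf(2)[OF c] by blast+
          have min_le: "min_max h q S (x s) \<le> h i (x s)"
            using c by (simp add: i(3) min_max_def)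
          have "\<forall>\<^sub>F r in at_right s. v \<le> h i (x r)"
          \<comment> \<open>A leaf strictly above the level stays there by continuity; only a leaf
            exactly at the level calls for the derivative condition.\<close>
          proof (cases "v < h i (x s)")
            case True
            have "((\<lambda>t. h i (x t)) \<longlongrightarrow> h i (x s)) (at s within {0..T})"
              using cont[OF i(2)] s by (auto simp: continuous_on_def)
            then have "((\<lambda>t. h i (x t)) \<longlongrightarrow> h i (x s)) (at s within {s..T})"
              by (rule tendsto_within_subset) (use s in auto)
            then have "\<forall>\<^sub>F r in at_right s. v < h i (x r)"
              using True s(3) by (simp add: at_within_Icc_at_right order_tendstoD(1))
            then show ?thesis
              by eventually_elim simp
          next
            case False
            \<comment> \<open>The chain \<open>v\<close> \<le> \<open>min_max\<close> \<le>
              \<open>h i\<close> \<le> \<open>v\<close> at \<open>x s\<close> collapses, so clause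
              \<open>c\<close> attains the minimum and is \<delta>-active.\<close>
            with s min_le have eq: "h i (x s) = v" "min_max h q S (x s) = v"
              by (auto simp: A_def)
            then have "c \<in> active_clauses h q S \<delta> (x s)"
              using c i(3) \<open>0 < \<delta>\<close> by (simp add: active_clauses_def)
            then have "v \<in> {-b<..<a}"
              "0 \<le> lie f (h i) (x s) + lie_row G (h i) (x s) \<bullet> ustar (x s) + \<alpha> v"
              using assms(11)[of "x s" c] inD[of s] s
              by (auto simp: Let_def dual_lie_eq dual_lie_row_eq eq simp flip: i_def)
            then have "0 < lie f (h i) (x s) + lie_row G (h i) (x s) \<bullet> ustar (x s)"
              using ext_class_K_neg[OF assms(7) _ \<open>v < 0\<close>] by fastforce
            then obtain d where d: "0 < d"
              "\<And>k. 0 < k \<Longrightarrow> s + k \<in> {0..T} \<Longrightarrow> k < d \<Longrightarrow> h i (x s) < h i (x (s + k))"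
              using has_real_derivative_pos_inc_right[OF deriv[OF i(2)], of s] s by auto
            \<comment> \<open>The derivative is taken within \<open>{0..T}\<close>, so the increase
              is known only while \<open>r\<close> stays in that interval; hence the cap at
              \<open>T\<close>.\<close>
            have "v \<le> h i (x r)" if "s < r" "r < min T (s + d)" for r
              using d(2)[of "r - s"] that s eq by auto
            then show ?thesis
              using d(1) s(3) by (intro eventually_at_rightI[of s "min T (s + d)"]) auto
          qed
          then show ?thesis
            using i(1) by (auto elim: eventually_mono)
        qed
        \<comment> \<open>There are finitely many clauses, so their right neighbourhoods of
          \<open>s\<close> have a common one.\<close>
        then have "\<forall>\<^sub>F r in at_right s. \<forall>c\<in>{1..q}. \<exists>i\<in>set (S c). v \<le> h i (x r)"
          by (intro eventually_ball_finite) auto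
        moreover have "\<forall>\<^sub>F r in at_right s. r \<in> {s<..<T}"
          using s(3) by (intro eventually_at_rightI[of s T]) auto
        ultimately have "\<forall>\<^sub>F r in at_right s. r \<in> A \<and> s < r \<and> r \<le> T"
          by eventually_elim (use s in \<open>auto simp: A_def ge_iff\<close>)
        then show ?thesis
          using eventually_happens'[OF trivial_limit_at_right_real] by blast
      qed
      ultimately have "T \<in> A"
        using T(2) by (intro closed_last_point[of A 0 T])
      then show ?thesis by (simp add: A_def)
    qed
    show ?thesis
      \<comment> \<open>Letting \<open>v\<close> tend to 0 from below recovers the bound at level
        0.\<close>
      using barrier by (rule dense_le)
  qed
  then show ?thesis
    by (auto simp: forward_invariant_def ode_solution_on_def)
qed

end
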